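(* Let $n\ge 1$ and let $\mathbf{A}_l=\sigma_0\otimes\sigma_1\otimes\dots\otimes\sigma_{n-1}$ with each $\sigma_k\in\mathbb{S}$, where $\mathbb{S}$ is the Sigma basis. Let $\mathbf{A}_l^c=\bar{\mathbf{A}}_l-\mathbf{A}_l$ be the orthogonal complement of $\mathbf{A}_l$, where $\bar{\mathbf{A}}_l$ is the unitary completion of $\mathbf{A}_l$. Then the operator on $n+1$ qubits $$\mathbf{U}_l=\begin{bmatrix}\mathbf{A}_l & \mathbf{A}_l^c\\ \mathbf{A}_l^c & \mathbf{A}_l\end{bmatrix}$$ can be implemented using at most $n+1$ single-qubit gates and one $C^mX$ gate, where $m\le n$.
   Context: The Sigma basis is $\mathbb{S}=\{\mathbf{I}_2,\ \sigma_+,\ \sigma_-,\ \sigma_+\sigma_-,\ \sigma_-\sigma_+\}$ with $\sigma_+=|0\rangle\langle 1|=\begin{bmatrix}0&1\\0&0\end{bmatrix}$, $\sigma_-=|1\rangle\langle 0|=\begin{bmatrix}0&0\\1&0\end{bmatrix}$, $\sigma_+\sigma_-=|0\rangle\langle 0|=\begin{bmatrix}1&0\\0&0\end{bmatrix}$, $\sigma_-\sigma_+=|1\rangle\langle 1|=\begin{bmatrix}0&0\\0&1\end{bmatrix}$. For $\mathbf{A}_l=\otimes_k\sigma_k$ with $\sigma_k\in\mathbb{S}$, the unitary completion used is $\bar{\mathbf{A}}_l=\otimes_k\bar\sigma_k$, where $\bar\sigma_k=\sigma_x=\begin{bmatrix}0&1\\1&0\end{bmatrix}$ if $\sigma_k\in\{\sigma_+,\sigma_-\}$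 and $\bar\sigma_k=\mathbf{I}_2$ if $\sigma_k\in\{\mathbf{I}_2,\sigma_+\sigma_-,\sigma_-\sigma_+\}$. The orthogonal complement is $\mathbf{A}_l^c:=\bar{\mathbf{A}}_l-\mathbf{A}_l$. The $n+1$ qubits are an ancilla qubit $a_0$ (the most significant one, indexing the $2\times 2$ block structure) and qubits $q_0,\dots,q_{n-1}$ on which the tensor factors $\sigma_0,\dots,\sigma_{n-1}$ act. A $C^mX$ gate has $m$ control qubits and one target qubit; each control is either closed (active when the control qubit is $1$) or open (active when it is $0$), and $X=\sigma_x$ is applied to the target exactly when all controls are active; the gate acts as the identity on the remaining qubits. $C^0X$ is the gate $X$, $C^1X$ is CNOT, and $C^2X$ is the Toffoli gate. "Implemented using" certain gates means that the operator equals a product of those gates, each acting on the $n+1$ qubits. *)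

theory Defs
  imports Jordan_Normal_Form.Schur_Decomposition
begin

section \<open>Tensor products\<close>

definition kron :: "complex mat \<Rightarrow> complex mat \<Rightarrow> complex mat" (infixl "\<otimes>\<^sub>K" 70) where
  "A \<otimes>\<^sub>K B = mat (dim_row A * dim_row B) (dim_col A * dim_col B)
     (\<lambda>(i, j). A $$ (i div dim_row B, j div dim_col B) * B $$ (i mod dim_row B, j mod dim_col B))"

definition tensor_list :: "complex mat list \<Rightarrow> complex mat" where
  "tensor_list As = foldr (\<otimes>\<^sub>K) As (1\<^sub>m 1)"

section \<open>The Sigma basis, unitary completion and orthogonal complement\<close>

definition sigma_plus :: "complex mat" where
  "sigma_plus = mat_of_rows_list 2 [[0, 1], [0, 0]]"

definition sigma_minus :: "complex mat" where
  "sigma_minus = mat_of_rows_list 2 [[0, 0], [1, 0]]"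

definition sigma_x :: "complex mat" where
  "sigma_x = mat_of_rows_list 2 [[0, 1], [1, 0]]"

definition sigma_basis :: "complex mat set" where
  "sigma_basis =
     {1\<^sub>m 2, sigma_plus, sigma_minus, sigma_plus * sigma_minus, sigma_minus * sigma_plus}"

(* Only meaningful on sigma_basis. *)
definition sigma_bar :: "complex mat \<Rightarrow> complex mat" where
  "sigma_bar s = (if s \<in> {sigma_plus, sigma_minus} then sigma_x else 1\<^sub>m 2)"

definition sigma_term :: "nat \<Rightarrow> (nat \<Rightarrow> complex mat) \<Rightarrow> complex mat" where
  "sigma_term n \<sigma> = tensor_list (map \<sigma> [0..<n])"

definition unitary_completion :: "nat \<Rightarrow> (nat \<Rightarrow> complex mat) \<Rightarrow> complex mat" where
  "unitary_completion n \<sigma> = tensor_list (map (\<lambda>k. sigma_bar (\<sigma> k)) [0..<n])"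

definition orth_complement :: "nat \<Rightarrow> (nat \<Rightarrow> complex mat) \<Rightarrow> complex mat" where
  "orth_complement n \<sigma> = unitary_completion n \<sigma> - sigma_term n \<sigma>"

definition U_op :: "nat \<Rightarrow> (nat \<Rightarrow> complex mat) \<Rightarrow> complex mat" where
  "U_op n \<sigma> =
     four_block_mat (sigma_term n \<sigma>) (orth_complement n \<sigma>)
                    (orth_complement n \<sigma>) (sigma_term n \<sigma>)"

section \<open>Gates on N qubits\<close>

(* Qubits are numbered 0, ..., N - 1 from the most significant one, so that qubit q is the
   q-th factor of the tensor product. In U_op the ancilla is qubit 0 and q_k is qubit k + 1. *)

definition qubit_value :: "nat \<Rightarrow> nat \<Rightarrow> nat \<Rightarrow> bool" where
  "qubit_value N i q = bit i (N - 1 - q)"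

definition unitary2 :: "complex mat \<Rightarrow> bool" where
  "unitary2 u \<longleftrightarrow> u \<in> carrier_mat 2 2 \<and> mat_adjoint u * u = 1\<^sub>m 2 \<and> u * mat_adjoint u = 1\<^sub>m 2"

definition is_single_qubit_gate :: "nat \<Rightarrow> complex mat \<Rightarrow> bool" where
  "is_single_qubit_gate N G \<longleftrightarrow>
     (\<exists>q<N. \<exists>u. unitary2 u \<and> G = 1\<^sub>m (2 ^ q) \<otimes>\<^sub>K u \<otimes>\<^sub>K 1\<^sub>m (2 ^ (N - 1 - q)))"

(* The domain of ctl is the set of control qubits: Some True is a closed control,
   Some False an open one. *)
definition controls_active :: "nat \<Rightarrow> (nat \<rightharpoonup> bool) \<Rightarrow> nat \<Rightarrow> bool" where
  "controls_active N ctl i \<longleftrightarrow> (\<forall>p\<in>dom ctl. ctl p = Some (qubit_value N i p))"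

definition mcx_gate :: "nat \<Rightarrow> (nat \<rightharpoonup> bool) \<Rightarrow> nat \<Rightarrow> complex mat" where
  "mcx_gate N ctl t = mat (2 ^ N) (2 ^ N) (\<lambda>(r, c).
     if \<forall>q<N. qubit_value N r q =
          (if q = t \<and> controls_active N ctl c then \<not> qubit_value N c q else qubit_value N c q)
     then 1 else 0)"

definition is_mcx_gate :: "nat \<Rightarrow> nat \<Rightarrow> complex mat \<Rightarrow> bool" where
  "is_mcx_gate N m G \<longleftrightarrow>
     (\<exists>ctl t. t < N \<and> dom ctl \<subseteq> {..<N} - {t} \<and> card (dom ctl) = m \<and> G = mcx_gate N ctl t)"

definition gate_product :: "nat \<Rightarrow> complex mat list \<Rightarrow> complex mat" where
  "gate_product N gs = foldr (*) gs (1\<^sub>m (2 ^ N))"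

end

theory Submission
  imports Defs
begin

text \<open>Write \<open>F\<close> for the set of qubits whose factor is \<open>\<sigma>\<^sub>+\<close> or \<open>\<sigma>\<^sub>-\<close>. Both the term and its unitary
  completion send a basis vector \<open>j\<close> to \<open>j\<close> with the bits in \<open>F\<close> flipped, except that the term
  annihilates \<open>j\<close> unless every non-identity factor sees the bit that its only nonzero column
  selects. Hence \<open>U\<close> permutes the basis: it flips the bits in \<open>F\<close>, and it flips the ancilla
  exactly when one of these bit conditions fails. That is a multi-controlled \<open>X\<close> on the
  ancilla, followed by an \<open>X\<close> on the ancilla and on each qubit in \<open>F\<close>.\<close>

section \<open>Basis maps\<close>

lemma nat_less_two_power_iff_bits:
  fixes r :: nat
  shows "r < 2 ^ N \<longleftrightarrow> (\<forall>m\<ge>N. \<not> bit r m)"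
proof -
  have "r < 2 ^ N \<longleftrightarrow> take_bit N r = r" by (simp add: take_bit_nat_eq_self_iff)
  also have "\<dots> \<longleftrightarrow> (\<forall>m\<ge>N. \<not> bit r m)"
    unfolding bit_eq_iff[of "take_bit N r"] bit_take_bit_iff using not_less by auto
  finally show ?thesis .
qed

lemma nat_eq_iff_bits_less:
  fixes r s :: nat
  assumes "r < 2 ^ N" "s < 2 ^ N"
  shows "r = s \<longleftrightarrow> (\<forall>m<N. bit r m = bit s m)"
  using assms unfolding nat_less_two_power_iff_bits bit_eq_iff[of r]
  by auto (metis not_less)+

text \<open>Qubits are numbered from the most significant one and bits from the least; this
  reindexing passes between the two orders.\<close>

lemma all_less_reverse: "(\<forall>q<N. P (N - 1 - q)) \<longleftrightarrow> (\<forall>m<N. P m)" for N :: nat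
proof
  assume *: "\<forall>q<N. P (N - 1 - q)"
  show "\<forall>m<N. P m"
  proof (intro allI impI)
    fix m assume "m < N"
    then have "N - 1 - (N - 1 - m) = m" "N - 1 - m < N" by auto
    with * show "P m" by metis
  qed
qed auto

lemma flip_bit_less_two_power:
  fixes c :: nat
  assumes "c < 2 ^ N" "m < N"
  shows "flip_bit m c < 2 ^ N"
  using assms unfolding nat_less_two_power_iff_bits by (auto simp: bit_flip_bit_iff)

text \<open>Distinctness excludes repeated positions, whose flips would cancel.\<close>

lemma bit_foldr_flip_bit:
  fixes c :: nat
  assumes "distinct ms"
  shows "bit (foldr flip_bit ms c) m \<longleftrightarrow> (bit c m \<noteq> (m \<in> set ms))"
  using assms by (induction ms) (auto simp: bit_flip_bit_iff)

lemma foldr_flip_bit_less_two_power: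
  fixes c :: nat
  assumes "c < 2 ^ N" "set ms \<subseteq> {..<N}"
  shows "foldr flip_bit ms c < 2 ^ N"
  using assms by (induction ms) (auto simp: flip_bit_less_two_power)

text \<open>The linear map sending the basis vector \<open>c\<close> to the basis vector
  \<open>f c\<close>; column \<open>c\<close> is zero if \<open>f c\<close> is out of range.
  Circuits thereby become compositions of functions on indices.\<close>

definition basis_map :: "nat \<Rightarrow> (nat \<Rightarrow> nat) \<Rightarrow> complex mat" where
  "basis_map N f = mat (2 ^ N) (2 ^ N) (\<lambda>(r, c). of_bool (r = f c))"

text \<open>The sum over intermediate indices keeps only \<open>g c\<close>, which must therefore
  lie in range. If \<open>f (g c)\<close> is out of range, column \<open>c\<close> vanishes on both
  sides.\<close>

lemma basis_map_mult:
  assumes "\<And>c. c < 2 ^ N \<Longrightarrow> g c < 2 ^ N"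
  shows "basis_map N f * basis_map N g = basis_map N (f \<circ> g)"
proof (rule eq_matI)
  fix r c assume "r < dim_row (basis_map N (f \<circ> g))" "c < dim_col (basis_map N (f \<circ> g))"
  then have rc: "r < 2 ^ N" "c < 2 ^ N" by (auto simp: basis_map_def)
  have "(basis_map N f * basis_map N g) $$ (r, c)
      = (\<Sum>k<2 ^ N. of_bool (r = f k) * of_bool (k = g c))"
    using rc by (simp add: basis_map_def scalar_prod_def lessThan_atLeast0)
  also have "\<dots> = (\<Sum>k<2 ^ N. if k = g c then of_bool (r = f k) else 0)"
    by (rule sum.cong) auto
  also have "\<dots> = basis_map N (f \<circ> g) $$ (r, c)"
    using rc assms[of c] by (simp add: basis_map_def)
  finally show "(basis_map N f * basis_map N g) $$ (r, c) = basis_map N (f \<circ> g) $$ (r, c)" .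
qed (auto simp: basis_map_def)

lemma mcx_gate_eq_basis_map:
  assumes "t < N"
  shows "mcx_gate N ctl t
    = basis_map N (\<lambda>c. if controls_active N ctl c then flip_bit (N - 1 - t) c else c)"
    (is "_ = basis_map N ?f")
proof (rule eq_matI)
  fix r c assume "r < dim_row (basis_map N ?f)" "c < dim_col (basis_map N ?f)"
  then have rc: "r < 2 ^ N" "c < 2 ^ N" by (auto simp: basis_map_def)
  have f: "?f c < 2 ^ N"
    using assms rc by (auto simp: flip_bit_less_two_power)
  have "(\<forall>q<N. qubit_value N r q =
          (if q = t \<and> controls_active N ctl c then \<not> qubit_value N c q else qubit_value N c q))
      \<longleftrightarrow> (\<forall>q<N. bit r (N - 1 - q) = bit (?f c) (N - 1 - q))"
  proof -
    have "qubit_value N r q =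
          (if q = t \<and> controls_active N ctl c then \<not> qubit_value N c q else qubit_value N c q)
        \<longleftrightarrow> bit r (N - 1 - q) = bit (?f c) (N - 1 - q)" if "q < N" for q
    proof -
      \<comment> \<open>The subtraction is injective here because \<open>q\<close> and
        \<open>t\<close> both lie below \<open>N\<close>, so distinct qubits have distinct bit
        positions.\<close>
      have "N - 1 - t = N - 1 - q \<longleftrightarrow> q = t" using that assms by auto
      then show ?thesis by (simp add: qubit_value_def bit_flip_bit_iff)
    qed
    then show ?thesis by blast
  qed
  also have "\<dots> \<longleftrightarrow> r = ?f c"
    unfolding all_less_reverse[of N "\<lambda>m. bit r m = bit (?f c) m"]
    using nat_eq_iff_bits_less[OF rc(1) f] by simp
  finally show "mcx_gate N ctl t $$ (r, c) = basis_map N ?f $$ (r, c)"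
    using rc by (simp add: mcx_gate_def basis_map_def)
qed (auto simp: mcx_gate_def basis_map_def)

section \<open>Single-qubit flips\<close>

lemma dim_sigma_x [simp]: "dim_row sigma_x = 2" "dim_col sigma_x = 2"
  by (auto simp: sigma_x_def mat_of_rows_list_def)

lemma sigma_x_index:
  "sigma_x $$ (of_bool x, of_bool y) = of_bool (x \<noteq> y)"
  by (cases x; cases y) (auto simp: sigma_x_def mat_of_rows_list_def)

lemma unitary2_sigma_x: "unitary2 sigma_x"
proof -
  have "mat_adjoint sigma_x = sigma_x"
  proof (rule eq_matI)
    fix i j assume "i < dim_row sigma_x" "j < dim_col sigma_x"
    then have "i = 0 \<or> i = 1" "j = 0 \<or> j = 1" by auto
    then show "mat_adjoint sigma_x $$ (i, j) = sigma_x $$ (i, j)"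
      by (auto simp: mat_adjoint_def mat_of_rows_def sigma_x_def mat_of_rows_list_def)
  qed (auto simp: mat_adjoint_def)
  moreover have "sigma_x * sigma_x = 1\<^sub>m 2"
    by (rule eq_matI)
      (auto simp: sigma_x_def mat_of_rows_list_def scalar_prod_def less_2_cases_iff)
  ultimately show ?thesis by (auto simp: unitary2_def)
qed

section \<open>Kronecker products and the \<open>X\<close> gate on one qubit\<close>

lemma dim_kron [simp]:
  "dim_row (A \<otimes>\<^sub>K B) = dim_row A * dim_row B" "dim_col (A \<otimes>\<^sub>K B) = dim_col A * dim_col B"
  by (auto simp: kron_def)

lemma kron_index:
  assumes "i < dim_row A * dim_row B" "j < dim_col A * dim_col B"
  shows "(A \<otimes>\<^sub>K B) $$ (i, j)
    = A $$ (i div dim_row B, j div dim_col B) * B $$ (i mod dim_row B, j mod dim_col B)"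
  using assms by (simp add: kron_def)

text \<open>An index is determined by its bits above \<open>k\<close>, its bit \<open>k\<close> and
  its bits below \<open>k\<close>. The three conditions are the nonvanishing conditions of the three
  factors of \<open>x_gate\<close>.\<close>

lemma eq_flip_bit_iff:
  fixes r c :: nat
  shows "r = flip_bit k c \<longleftrightarrow> r div 2 ^ k div 2 = c div 2 ^ k div 2 \<and>
    bit r k \<noteq> bit c k \<and> r mod 2 ^ k = c mod 2 ^ k" (is "?L \<longleftrightarrow> ?R")
proof
  have div: "x div 2 ^ k div 2 = drop_bit (Suc k) x" for x :: nat
    by (simp add: drop_bit_eq_div div_mult2_eq[symmetric] mult.commute)
  {
    assume ?L
    then show ?R
      unfolding div take_bit_eq_mod[symmetric]
      by (intro conjI bit_eqI) (auto simp: bit_drop_bit_eq bit_take_bit_iff bit_flip_bit_iff)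
  }
  {
    assume R: ?R
    show ?L
    proof (rule bit_eqI)
      fix m
      have high: "bit r (Suc k + i) = bit c (Suc k + i)" for i
        using R unfolding div by (metis bit_drop_bit_eq comp_apply)
      have low: "i < k \<Longrightarrow> bit r i = bit c i" for i
        using R unfolding take_bit_eq_mod[symmetric] by (metis bit_take_bit_iff)
      consider "m < k" | "m = k" | i where "m = Suc k + i"
        by (metis less_iff_Suc_add add_Suc nat_neq_iff)
      then show "bit r m = bit (flip_bit k c) m"
        using R high low by cases (auto simp: bit_flip_bit_iff)
    qed
  }
qed

definition x_gate :: "nat \<Rightarrow> nat \<Rightarrow> complex mat" where
  "x_gate N q = 1\<^sub>m (2 ^ q) \<otimes>\<^sub>K sigma_x \<otimes>\<^sub>K 1\<^sub>m (2 ^ (N - 1 - q))"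

lemma is_single_qubit_gate_x_gate: "q < N \<Longrightarrow> is_single_qubit_gate N (x_gate N q)"
  unfolding is_single_qubit_gate_def x_gate_def using unitary2_sigma_x by blast

lemma x_gate_eq_basis_map:
  assumes "q < N"
  shows "x_gate N q = basis_map N (flip_bit (N - 1 - q))"
proof -
  define k where "k = N - 1 - q"
  have N: "N = q + 1 + k" using assms by (auto simp: k_def)
  have k: "N - Suc q = k" by (simp add: k_def)
  \<comment> \<open>The grouping follows the left-nested Kronecker product, so that
    \<open>kron_index\<close> applies twice.\<close>
  have pw: "2 ^ N = (2 ^ q * 2) * (2 ^ k :: nat)" by (simp add: N power_add)
  have "x_gate N q = basis_map N (flip_bit k)"
  proof (rule eq_matI)
    fix r c assume "r < dim_row (basis_map N (flip_bit k))" "c < dim_col (basis_map N (flip_bit k))"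
    then have rc: "r < 2 ^ N" "c < 2 ^ N" by (auto simp: basis_map_def)
    have d: "r div 2 ^ k < 2 ^ q * 2" "c div 2 ^ k < 2 ^ q * 2"
      using rc unfolding pw by (auto simp: less_mult_imp_div_less)
    then have e: "r div 2 ^ k div 2 < 2 ^ q" "c div 2 ^ k div 2 < 2 ^ q"
      by (auto simp: less_mult_imp_div_less)
    have b: "x div 2 ^ k mod 2 = of_bool (bit x k)" for x :: nat
      by (simp add: bit_iff_odd mod_2_eq_odd)
    have "x_gate N q $$ (r, c) = of_bool (r div 2 ^ k div 2 = c div 2 ^ k div 2)
        * of_bool (bit r k \<noteq> bit c k) * of_bool (r mod 2 ^ k = c mod 2 ^ k)"
      unfolding x_gate_def k_def[symmetric]
      using rc d e by (simp add: kron_index pw b sigma_x_index)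
    also have "\<dots> = of_bool (r = flip_bit k c)"
      unfolding eq_flip_bit_iff[of r k c] by simp
    finally show "x_gate N q $$ (r, c) = basis_map N (flip_bit k) $$ (r, c)"
      using rc by (simp add: basis_map_def)
  qed (auto simp: basis_map_def x_gate_def pw k)
  then show ?thesis by (simp add: k_def)
qed

text \<open>The rightmost factor acts first, so the flips are applied after \<open>f\<close>; each
  further gate composes on the left.\<close>

lemma gate_product_x_gates:
  assumes "set qs \<subseteq> {..<N}" and "\<And>c. c < 2 ^ N \<Longrightarrow> f c < 2 ^ N"
  shows "gate_product N (map (x_gate N) qs @ [basis_map N f])
    = basis_map N (\<lambda>c. foldr flip_bit (map (\<lambda>q. N - 1 - q) qs) (f c))"
  using assms(1)
proof (induction qs)
  case Nil
  have "basis_map N f \<in> carrier_mat (2 ^ N) (2 ^ N)" by (simp add: basis_map_def)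
  then show ?case by (simp add: gate_product_def)
next
  case (Cons q qs)
  let ?g = "\<lambda>c. foldr flip_bit (map (\<lambda>q. N - 1 - q) qs) (f c)"
  have "gate_product N (map (x_gate N) (q # qs) @ [basis_map N f])
      = x_gate N q * basis_map N ?g"
    using Cons by (simp add: gate_product_def)
  also have "\<dots> = basis_map N (flip_bit (N - 1 - q) \<circ> ?g)"
  proof -
    have "?g c < 2 ^ N" if "c < 2 ^ N" for c
      using Cons.prems assms(2)[OF that] by (intro foldr_flip_bit_less_two_power) auto
    then show ?thesis
      using Cons.prems by (simp add: x_gate_eq_basis_map basis_map_mult)
  qed
  finally show ?case by (simp add: comp_def)
qed

section \<open>Entries of the block operator\<close>

lemma dim_tensor_list:
  assumes "\<forall>A\<in>set As. A \<in> carrier_mat 2 2"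
  shows "tensor_list As \<in> carrier_mat (2 ^ length As) (2 ^ length As)"
  using assms by (induction As) (auto simp: tensor_list_def)

text \<open>The head of the list is the most significant factor: division by
  \<open>2 ^ length As\<close> for the tail \<open>As\<close> isolates the top bit, which indexes
  the head, and the remainder indexes the tail.\<close>

lemma tensor_list_index:
  assumes "\<forall>A\<in>set As. A \<in> carrier_mat 2 2" "i < 2 ^ length As" "j < 2 ^ length As"
  shows "tensor_list As $$ (i, j) = (\<Prod>k<length As.
    (As ! k) $$ (of_bool (bit i (length As - 1 - k)), of_bool (bit j (length As - 1 - k))))"
  using assms
proof (induction As arbitrary: i j)
  case Nil
  then show ?case by (simp add: tensor_list_def)
next
  case (Cons A As)
  let ?L = "length As"
  have dims: "dim_row (tensor_list As) = 2 ^ ?L" "dim_col (tensor_list As) = 2 ^ ?L"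
    using dim_tensor_list[of As] Cons.prems by auto
  have A: "dim_row A = 2" "dim_col A = 2" using Cons.prems by auto
  have top: "x div 2 ^ ?L = of_bool (bit x ?L)" if "x < 2 ^ Suc ?L" for x :: nat
  proof -
    have "x div 2 ^ ?L < 2" using that by (auto simp: less_mult_imp_div_less)
    then show ?thesis by (auto simp: bit_iff_odd less_2_cases_iff)
  qed
  have rest: "tensor_list As $$ (i mod 2 ^ ?L, j mod 2 ^ ?L) = (\<Prod>k<?L.
      (As ! k) $$ (of_bool (bit i (?L - 1 - k)), of_bool (bit j (?L - 1 - k))))"
    using Cons.prems by (subst Cons.IH)
      (auto simp: take_bit_eq_mod[symmetric] bit_take_bit_iff intro!: prod.cong)
  have "tensor_list (A # As) $$ (i, j) = A $$ (i div 2 ^ ?L, j div 2 ^ ?L)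
      * tensor_list As $$ (i mod 2 ^ ?L, j mod 2 ^ ?L)"
  proof -
    have "tensor_list (A # As) = A \<otimes>\<^sub>K tensor_list As" by (simp add: tensor_list_def)
    then show ?thesis
      using Cons.prems kron_index[of i A "tensor_list As" j] by (simp add: dims A)
  qed
  also have "\<dots> = A $$ (of_bool (bit i ?L), of_bool (bit j ?L)) * (\<Prod>k<?L.
      (As ! k) $$ (of_bool (bit i (?L - 1 - k)), of_bool (bit j (?L - 1 - k))))"
    unfolding rest using Cons.prems by (simp add: top)
  finally show ?case
    by (simp add: prod.lessThan_Suc_shift del: prod.lessThan_Suc)
qed

lemma tensor_list_upt_index:
  assumes "\<And>k. k < n \<Longrightarrow> A k \<in> carrier_mat 2 2" "i < 2 ^ n" "j < 2 ^ n"
    and "\<And>k x y. k < n \<Longrightarrow> A k $$ (of_bool x, of_bool y) = of_bool (P k x y)"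
  shows "tensor_list (map A [0..<n]) $$ (i, j)
    = of_bool (\<forall>k<n. P k (bit i (n - 1 - k)) (bit j (n - 1 - k)))"
proof -
  have "tensor_list (map A [0..<n]) $$ (i, j)
      = (\<Prod>k<n. of_bool (P k (bit i (n - 1 - k)) (bit j (n - 1 - k))))"
    using assms by (subst tensor_list_index) (auto intro!: prod.cong)
  also have "\<dots> = of_bool (\<forall>k<n. P k (bit i (n - 1 - k)) (bit j (n - 1 - k)))"
    by (auto simp: prod_zero_iff)
  finally show ?thesis .
qed

section \<open>Entries of the Sigma basis elements and their completions\<close>

definition flips :: "complex mat \<Rightarrow> bool" where
  "flips s \<longleftrightarrow> s \<in> {sigma_plus, sigma_minus}"

text \<open>The value selected is the column of the nonzero entry.\<close>

definition selected :: "complex mat \<Rightarrow> bool option" where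
  "selected s = (if s = 1\<^sub>m 2 then None
     else Some (s \<in> {sigma_plus, sigma_minus * sigma_plus}))"

lemma sigma_explicit:
  "sigma_plus = mat 2 2 (\<lambda>(i, j). of_bool (i = 0 \<and> j = 1))"
  "sigma_minus = mat 2 2 (\<lambda>(i, j). of_bool (i = 1 \<and> j = 0))"
  by (rule eq_matI; auto simp: sigma_plus_def sigma_minus_def mat_of_rows_list_def
      less_2_cases_iff)+

lemma sigma_mult_explicit:
  "sigma_plus * sigma_minus = mat 2 2 (\<lambda>(i, j). of_bool (i = 0 \<and> j = 0))"
  "sigma_minus * sigma_plus = mat 2 2 (\<lambda>(i, j). of_bool (i = 1 \<and> j = 1))"
  by (rule eq_matI; auto simp: sigma_explicit scalar_prod_def)+

lemma sigma_basis_carrier: "s \<in> sigma_basis \<Longrightarrow> s \<in> carrier_mat 2 2"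
  unfolding sigma_basis_def sigma_mult_explicit by (auto simp: sigma_explicit)

text \<open>\<open>flips\<close> and \<open>selected\<close> test equality of matrices; comparing
  four entries settles which basis elements coincide.\<close>

lemma mat_2_eq_iff:
  "A = B \<longleftrightarrow> A $$ (0, 0) = B $$ (0, 0) \<and> A $$ (0, 1) = B $$ (0, 1) \<and>
     A $$ (1, 0) = B $$ (1, 0) \<and> A $$ (1, 1) = B $$ (1, 1)"
  if "A \<in> carrier_mat 2 2" "B \<in> carrier_mat 2 2"
proof
  assume "A $$ (0, 0) = B $$ (0, 0) \<and> A $$ (0, 1) = B $$ (0, 1) \<and>
     A $$ (1, 0) = B $$ (1, 0) \<and> A $$ (1, 1) = B $$ (1, 1)"
  then show "A = B"
    using that by (intro eq_matI) (auto simp: less_2_cases_iff)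
qed auto

text \<open>A non-identity element has a single nonzero entry, equal to 1: its column is the
  selected value, and its row differs from the column exactly for \<sigma>+ and \<sigma>-. The
  identity selects nothing.\<close>

lemma sigma_basis_index:
  assumes "s \<in> sigma_basis"
  shows "s $$ (of_bool x, of_bool y)
    = of_bool ((x \<longleftrightarrow> y \<noteq> flips s) \<and> (\<forall>b. selected s = Some b \<longrightarrow> b = y))"
  using assms
  unfolding sigma_basis_def flips_def selected_def insert_iff empty_iff
  unfolding sigma_mult_explicit unfolding sigma_explicit
  by (elim disjE; cases x; cases y; simp add: mat_2_eq_iff ex_bool_eq)

text \<open>The completion keeps the flip condition of \<open>sigma_basis_index\<close> and drops
  the selection.\<close>

lemma sigma_bar_index:
  "sigma_bar s $$ (of_bool x, of_bool y) = of_bool (x \<longleftrightarrow> y \<noteq> flips s)"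
  by (cases x; cases y)
    (auto simp: sigma_bar_def flips_def sigma_x_def mat_of_rows_list_def)

lemma sigma_bar_carrier: "sigma_bar s \<in> carrier_mat 2 2"
  by (auto simp: sigma_bar_def)

text \<open>Bit \<open>n\<close> chooses the block and the lower bits the entry in it. A diagonal
  block requires flip and selection; an off-diagonal one has the difference of flip and (flip and
  selection), that is, flip without selection.\<close>

lemma U_op_index:
  assumes \<sigma>: "\<And>k. k < n \<Longrightarrow> \<sigma> k \<in> sigma_basis" and rc: "r < 2 ^ (n + 1)" "c < 2 ^ (n + 1)"
  shows "U_op n \<sigma> $$ (r, c) = of_bool
    ((\<forall>k<n. bit r (n - 1 - k) \<longleftrightarrow> bit c (n - 1 - k) \<noteq> flips (\<sigma> k)) \<and>
     (bit r n = bit c n \<longleftrightarrow>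
       (\<forall>k<n. \<forall>b. selected (\<sigma> k) = Some b \<longrightarrow> b = bit c (n - 1 - k))))"
proof -
  let ?flip = "\<forall>k<n. bit r (n - 1 - k) \<longleftrightarrow> bit c (n - 1 - k) \<noteq> flips (\<sigma> k)"
  let ?sel = "\<forall>k<n. \<forall>b. selected (\<sigma> k) = Some b \<longrightarrow> b = bit c (n - 1 - k)"
  let ?A = "sigma_term n \<sigma>" and ?B = "unitary_completion n \<sigma>"
  let ?i = "r mod 2 ^ n" and ?j = "c mod 2 ^ n"
  have bits: "bit (x mod 2 ^ n) (n - Suc k) = bit x (n - Suc k)" if "k < n" for k x :: nat
    using that by (auto simp: take_bit_eq_mod[symmetric] bit_take_bit_iff)
  have A: "?A $$ (?i, ?j) = of_bool (?flip \<and> ?sel)"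
    unfolding sigma_term_def
    by (subst tensor_list_upt_index[OF _ _ _ sigma_basis_index])
      (auto simp: \<sigma> sigma_basis_carrier bits)
  have B: "?B $$ (?i, ?j) = of_bool ?flip"
    unfolding unitary_completion_def
    by (subst tensor_list_upt_index[OF _ _ _ sigma_bar_index])
      (auto simp: sigma_bar_carrier bits)
  have dims: "?A \<in> carrier_mat (2 ^ n) (2 ^ n)" "?B \<in> carrier_mat (2 ^ n) (2 ^ n)"
    using dim_tensor_list[of "map \<sigma> [0..<n]"] dim_tensor_list[of "map (\<lambda>k. sigma_bar (\<sigma> k)) [0..<n]"]
    by (auto simp: sigma_term_def unitary_completion_def \<sigma> sigma_basis_carrier sigma_bar_carrier)
  \<comment> \<open>Translates the case distinction and offset of \<open>four_block_mat\<close> into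
    the top bit and the remainder.\<close>
  have split: "(\<not> bit x n \<and> x < 2 ^ n \<and> x mod 2 ^ n = x) \<or>
      (bit x n \<and> \<not> x < 2 ^ n \<and> x mod 2 ^ n = x - 2 ^ n)"
    if "x < 2 ^ (n + 1)" for x :: nat
  proof (cases "x < 2 ^ n")
    case True
    then show ?thesis by (simp add: bit_iff_odd)
  next
    case False
    then have "x div 2 ^ n = 1" "x mod 2 ^ n = x - 2 ^ n"
      using that by (auto simp: div_nat_eqI le_mod_geq)
    then show ?thesis using False by (simp add: bit_iff_odd)
  qed
  have small: "?i < 2 ^ n" "?j < 2 ^ n" by auto
  have "U_op n \<sigma> $$ (r, c) = (if bit r n = bit c n then ?A $$ (?i, ?j)
      else ?B $$ (?i, ?j) - ?A $$ (?i, ?j))"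
    using split[OF rc(1)] split[OF rc(2)] dims rc small
    by (auto simp: U_op_def orth_complement_def)
  then show ?thesis unfolding A B by auto
qed

lemma dim_U_op:
  assumes "\<And>k. k < n \<Longrightarrow> \<sigma> k \<in> sigma_basis"
  shows "U_op n \<sigma> \<in> carrier_mat (2 ^ (n + 1)) (2 ^ (n + 1))"
proof -
  have "sigma_term n \<sigma> \<in> carrier_mat (2 ^ n) (2 ^ n)"
    using dim_tensor_list[of "map \<sigma> [0..<n]"] assms
    by (auto simp: sigma_term_def sigma_basis_carrier)
  then show ?thesis by (auto simp: U_op_def)
qed

section \<open>Assembly of the circuit\<close>

theorem theorem2:
  fixes n :: nat and \<sigma> :: "nat \<Rightarrow> complex mat"
  assumes "n \<ge> 1"
    and "\<And>k. k < n \<Longrightarrow> \<sigma> k \<in> sigma_basis"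
  shows "\<exists>gs C hs m.
      m \<le> n \<and> is_mcx_gate (n + 1) m C \<and>
      (\<forall>g\<in>set (gs @ hs). is_single_qubit_gate (n + 1) g) \<and>
      length (gs @ hs) \<le> n + 1 \<and>
      U_op n \<sigma> = gate_product (n + 1) (gs @ [C] @ hs)"
proof -
  \<comment> \<open>Qubit \<open>p\<close> carries the factor \<open>p - 1\<close>, and the ancilla,
    qubit 0, is left free as the target. Each non-identity factor gives one control, closed if it
    selects 1 and open if it selects 0.\<close>
  define ctl where "ctl = (\<lambda>p. if 1 \<le> p \<and> p \<le> n then selected (\<sigma> (p - 1)) else None)"
  \<comment> \<open>The gate \<open>C\<close> flips the ancilla when all selections hold, whereas
    \<open>U_op\<close> must flip it when one fails; the \<open>X\<close> on qubit 0 makes up for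
    this.\<close>
  define qs where "qs = 0 # map Suc (filter (\<lambda>k. flips (\<sigma> k)) [0..<n])"
  define C where "C = mcx_gate (n + 1) ctl 0"
  define f where "f c = (if controls_active (n + 1) ctl c then flip_bit n c else c)" for c :: nat
  define h where "h c = foldr flip_bit (map (\<lambda>q. n + 1 - 1 - q) qs) (f c)" for c
  have dom: "dom ctl \<subseteq> {1..n}" by (auto simp: ctl_def split: if_splits)
  have "card (dom ctl) \<le> n" using card_mono[OF _ dom] by simp
  moreover have "is_mcx_gate (n + 1) (card (dom ctl)) C"
    unfolding is_mcx_gate_def C_def using dom by (intro exI[of _ ctl] exI[of _ 0]) auto
  moreover have qs: "set qs \<subseteq> {..<n + 1}" by (auto simp: qs_def)
  then have "\<forall>g\<in>set (map (x_gate (n + 1)) qs @ []). is_single_qubit_gate (n + 1) g"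
    by (auto intro!: is_single_qubit_gate_x_gate)
  moreover have "length (map (x_gate (n + 1)) qs @ []) \<le> n + 1"
    using length_filter_le[of "\<lambda>k. flips (\<sigma> k)" "[0..<n]"] by (simp add: qs_def)
  \<comment> \<open>All \<open>X\<close> gates stand to the left of \<open>C\<close>, hence act
    after it has read its controls; \<open>hs\<close> is empty.\<close>
  moreover have "U_op n \<sigma> = gate_product (n + 1) (map (x_gate (n + 1)) qs @ [C] @ [])"
  proof -
    have C: "C = basis_map (n + 1) f"
      by (simp add: C_def f_def[abs_def] mcx_gate_eq_basis_map cong: if_cong)
    have f_less: "f c < 2 ^ (n + 1)" if "c < 2 ^ (n + 1)" for c
      unfolding f_def using that flip_bit_less_two_power[of c "n + 1" n] by simp
    have h_less: "h c < 2 ^ (n + 1)" if "c < 2 ^ (n + 1)" for c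
      unfolding h_def using qs f_less[OF that]
      by (intro foldr_flip_bit_less_two_power) auto
    have active: "controls_active (n + 1) ctl c \<longleftrightarrow>
        (\<forall>k<n. \<forall>b. selected (\<sigma> k) = Some b \<longrightarrow> b = bit c (n - 1 - k))" (is "_ \<longleftrightarrow> ?R") for c
    proof
      assume act: "controls_active (n + 1) ctl c"
      show ?R
      proof (intro allI impI)
        fix k b assume "k < n" "selected (\<sigma> k) = Some b"
        then have "ctl (Suc k) = Some b" by (simp add: ctl_def)
        with act have "Some b = Some (qubit_value (n + 1) c (Suc k))"
          unfolding controls_active_def by (metis domI)
        then show "b = bit c (n - 1 - k)" by (simp add: qubit_value_def)
      qed
    next
      assume R: ?R
      show "controls_active (n + 1) ctl c"
        unfolding controls_active_def
      proof
        fix p assume "p \<in> dom ctl"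
        then obtain b where b: "ctl p = Some b" by auto
        then have p: "1 \<le> p" "p \<le> n" "selected (\<sigma> (p - 1)) = Some b"
          by (auto simp: ctl_def split: if_splits)
        then have "p - 1 < n" by auto
        with R p have "b = bit c (n - 1 - (p - 1))" by blast
        then show "ctl p = Some (qubit_value (n + 1) c p)"
          using b p by (simp add: qubit_value_def)
      qed
    qed
    \<comment> \<open>Injectivity of the truncated subtraction uses that all listed qubits are at
      most \<open>n\<close>.\<close>
    have dist: "distinct (map (\<lambda>q. n + 1 - 1 - q) qs)"
      using qs by (auto simp: qs_def distinct_map inj_on_def)
    have bit_h: "bit (h c) m \<longleftrightarrow> (bit (f c) m \<noteq> (m \<in> (\<lambda>q. n - q) ` set qs))" for c m
      unfolding h_def bit_foldr_flip_bit[OF dist] by simp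
    have mem_n: "n \<in> (\<lambda>q. n - q) ` set qs"
      by (auto simp: qs_def)
    have mem_k: "n - 1 - k \<in> (\<lambda>q. n - q) ` set qs \<longleftrightarrow> flips (\<sigma> k)" if "k < n" for k
    proof
      assume "n - 1 - k \<in> (\<lambda>q. n - q) ` set qs"
      then obtain q where q: "q \<in> set qs" "n - 1 - k = n - q" by auto
      then have "q = Suc k" using that qs by auto
      with q show "flips (\<sigma> k)" by (auto simp: qs_def)
    next
      assume "flips (\<sigma> k)"
      then have "Suc k \<in> set qs" using that by (auto simp: qs_def)
      then show "n - 1 - k \<in> (\<lambda>q. n - q) ` set qs" by force
    qed
    have "U_op n \<sigma> = basis_map (n + 1) h"
    proof (rule eq_matI)
      fix r c assume "r < dim_row (basis_map (n + 1) h)" "c < dim_col (basis_map (n + 1) h)"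
      then have rc: "r < 2 ^ (n + 1)" "c < 2 ^ (n + 1)" by (auto simp: basis_map_def)
      have "r = h c \<longleftrightarrow> (\<forall>m<n. bit r m = bit (h c) m) \<and> bit r n = bit (h c) n"
        unfolding nat_eq_iff_bits_less[OF rc(1) h_less[OF rc(2)]] by (auto simp: less_Suc_eq)
      also have "(\<forall>m<n. bit r m = bit (h c) m)
          \<longleftrightarrow> (\<forall>k<n. bit r (n - 1 - k) = bit (h c) (n - 1 - k))"
        using all_less_reverse[of n "\<lambda>m. bit r m = bit (h c) m"] by simp
      \<comment> \<open>Below bit \<open>n\<close> the map \<open>f\<close> changes nothing, so only
        the \<open>X\<close> gates contribute.\<close>
      also have "\<dots> \<longleftrightarrow> (\<forall>k<n. bit r (n - 1 - k) \<longleftrightarrow> bit c (n - 1 - k) \<noteq> flips (\<sigma> k))"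
        unfolding bit_h using mem_k by (auto simp: f_def bit_flip_bit_iff)
      \<comment> \<open>The ancilla is flipped twice if the controls are active, and once
        otherwise.\<close>
      also have "bit r n = bit (h c) n \<longleftrightarrow>
          (bit r n = bit c n \<longleftrightarrow> controls_active (n + 1) ctl c)"
        unfolding bit_h using mem_n by (auto simp: f_def bit_flip_bit_iff)
      finally show "U_op n \<sigma> $$ (r, c) = basis_map (n + 1) h $$ (r, c)"
        using rc unfolding active by (subst U_op_index[OF assms(2)]) (auto simp: basis_map_def)
    qed (use dim_U_op[of n \<sigma>] assms(2) in \<open>auto simp: basis_map_def\<close>)
    also have "\<dots> = gate_product (n + 1) (map (x_gate (n + 1)) qs @ [C] @ [])"
      using gate_product_x_gates[OF qs, of f] f_less by (simp add: C h_def[abs_def])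
    finally show ?thesis .
  qed
  ultimately show ?thesis by blast
qed

end
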